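(* For the complete bipartite graph $K_{m,n}$ with $m\ge n\ge 1$, $\bar{\gamma}_p(K_{m,n})=m-2$ if $m\ge 2$, and $\bar{\gamma}_p(K_{m,n})=0$ otherwise.
   Context: For $v\in V$, $N[v]$ is the closed neighborhood; for $S\subseteq V$, $N[S]=\bigcup_{v\in S}N[v]$. Define $\mathcal{P}^0(S)=N[S]$, $\mathcal{P}^{i+1}(S)=\mathcal{P}^i(S)\cup\{w : \{w\}=N[v]\setminus\mathcal{P}^i(S)\text{ for some } v\in\mathcal{P}^i(S)\}$, with eventual value $\mathcal{P}^\infty(S)$. $S$ is a power dominating set (PDS) if $\mathcal{P}^\infty(S)=V$, and a failed power dominating set (FPDS) otherwise. $\bar{\gamma}_p(G)$ is the maximum cardinality of an FPDS of $G$. *)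

theory Defs
  imports "Graph_Theory.Graph_Theory"
begin

text \<open>
  Undirected simple graphs are the finite symmetric loopfree digraphs without parallel arcs of
  locale \<open>graph\<close>, so out-neighbors are neighbors.
\<close>

definition closed_nbhd :: "('a, 'b) pre_digraph \<Rightarrow> 'a \<Rightarrow> 'a set" where
  "closed_nbhd G v = insert v {w. v \<rightarrow>\<^bsub>G\<^esub> w}"

definition closed_nbhd_set :: "('a, 'b) pre_digraph \<Rightarrow> 'a set \<Rightarrow> 'a set" where
  "closed_nbhd_set G S = (\<Union>v\<in>S. closed_nbhd G v)"

primrec pd_step :: "('a, 'b) pre_digraph \<Rightarrow> nat \<Rightarrow> 'a set \<Rightarrow> 'a set" where
  "pd_step G 0 S = closed_nbhd_set G S"
| "pd_step G (Suc i) S =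
     pd_step G i S \<union> {w. \<exists>v\<in>pd_step G i S. {w} = closed_nbhd G v - pd_step G i S}"

definition pd_final :: "('a, 'b) pre_digraph \<Rightarrow> 'a set \<Rightarrow> 'a set" where
  "pd_final G S = (THE X. \<forall>\<^sub>F i in sequentially. pd_step G i S = X)"

definition power_dominating :: "('a, 'b) pre_digraph \<Rightarrow> 'a set \<Rightarrow> bool" where
  "power_dominating G S \<longleftrightarrow> S \<subseteq> verts G \<and> pd_final G S = verts G"

definition failed_power_dominating :: "('a, 'b) pre_digraph \<Rightarrow> 'a set \<Rightarrow> bool" where
  "failed_power_dominating G S \<longleftrightarrow> S \<subseteq> verts G \<and> \<not> power_dominating G S"

text \<open>
  The maximum is over a finite set, which is nonempty as soon as the graph has a vertex, because
  then the empty set is a failed power dominating set (see below).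
\<close>

definition failed_pd_number :: "('a, 'b) pre_digraph \<Rightarrow> nat" where
  "failed_pd_number G = Max {card S |S. failed_power_dominating G S}"

lemma pd_step_mono: "i \<le> j \<Longrightarrow> pd_step G i S \<subseteq> pd_step G j S"
  by (rule lift_Suc_mono_le[of "\<lambda>i. pd_step G i S"]) auto

lemma (in fin_digraph) pd_step_subset: "S \<subseteq> verts G \<Longrightarrow> pd_step G i S \<subseteq> verts G"
proof (induction i)
  case 0
  then show ?case
    by (auto simp: closed_nbhd_set_def closed_nbhd_def dest: adj_in_verts)
next
  case (Suc i)
  then have "closed_nbhd G v \<subseteq> verts G" if "v \<in> pd_step G i S" for v
    using that by (auto simp: closed_nbhd_def dest: adj_in_verts)
  then show ?case
    using Suc by (auto; blast)
qed

lemma pd_final_eqI: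
  assumes "\<forall>\<^sub>F i in sequentially. pd_step G i S = X"
  shows "pd_final G S = X"
  unfolding pd_final_def
proof (rule the_equality)
  fix Y assume "\<forall>\<^sub>F i in sequentially. pd_step G i S = Y"
  with assms have "\<forall>\<^sub>F i in sequentially. Y = X"
    by eventually_elim simp
  then show "Y = X" by simp
qed (fact assms)

lemma (in fin_digraph) eventually_pd_step_eq_pd_final:
  assumes "S \<subseteq> verts G"
  shows "\<forall>\<^sub>F i in sequentially. pd_step G i S = pd_final G S"
proof -
  let ?P = "\<lambda>i. pd_step G i S"
  have "finite (range ?P)"
    by (rule finite_subset[of _ "Pow (verts G)"]) (use pd_step_subset[OF assms] in auto)
  moreover have "range ?P \<noteq> {}" by simp
  ultimately obtain k where k: "\<And>i. ?P k \<subseteq> ?P i \<Longrightarrow> ?P k = ?P i"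
    using finite_has_maximal[of "range ?P"] by auto
  have "\<forall>\<^sub>F i in sequentially. ?P i = ?P k"
    using eventually_ge_at_top[of k] by eventually_elim (use k pd_step_mono in metis)
  with pd_final_eqI[OF this] show ?thesis by simp
qed

lemma failed_power_dominating_empty:
  assumes "verts G \<noteq> {}"
  shows "failed_power_dominating G {}"
proof -
  have "pd_step G i {} = {}" for i
    by (induction i) (auto simp: closed_nbhd_set_def)
  then have "pd_final G {} = {}"
    by (intro pd_final_eqI) simp
  with assms show ?thesis
    by (auto simp: failed_power_dominating_def power_dominating_def)
qed

lemma (in fin_digraph) finite_failed_power_dominating:
  "finite {card S |S. failed_power_dominating G S}"
  by (rule finite_subset[of _ "card ` Pow (verts G)"])
     (auto simp: failed_power_dominating_def)

end

theory Submission
  imports Defs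
begin

text \<open>
  A set that meets both sides of the bipartition dominates at once. A nonempty subset \<open>S\<close> of one
  side \<open>U\<close> dominates the other side \<open>V\<close> and itself; afterwards every vertex of \<open>V\<close> sees exactly
  the vertices of \<open>U - S\<close> as unobserved neighbors, so the process finishes if \<open>U - S\<close> has at most
  one element and is stuck otherwise.
\<close>

text \<open>The sides are parameters without any size condition, so that each fact about subsets of
  \<open>U\<close> transfers to \<open>V\<close> through \<open>swap\<close>.\<close>

locale complete_bipartite_graph = graph G for G :: "('a, 'b) pre_digraph" +
  fixes U V :: "'a set"
  assumes verts_eq: "verts G = U \<union> V"
    and disjoint_sides: "U \<inter> V = {}"
    and arcs_ends_eq: "arcs_ends G = U \<times> V \<union> V \<times> U"
begin

lemma swap: "complete_bipartite_graph G V U"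
  using verts_eq disjoint_sides arcs_ends_eq by unfold_locales auto

lemma finite_sides: "finite U" "finite V"
  using finite_verts verts_eq by auto

lemma closed_nbhd_left: "u \<in> U \<Longrightarrow> closed_nbhd G u = insert u V"
  using disjoint_sides by (auto simp: closed_nbhd_def arcs_ends_eq)

lemma closed_nbhd_right: "v \<in> V \<Longrightarrow> closed_nbhd G v = insert v U"
  using disjoint_sides by (auto simp: closed_nbhd_def arcs_ends_eq)

text \<open>The iterates increase and never leave \<open>verts G\<close>, so the sequence is
  constant from step \<open>k\<close> on.\<close>

lemma power_dominating_if_step_eq_verts:
  assumes "S \<subseteq> verts G" and "pd_step G k S = verts G"
  shows "power_dominating G S"
proof -
  have "pd_step G i S = verts G" if "k \<le> i" for i
    using pd_step_mono[OF that, of G S] pd_step_subset[OF assms(1), of i] assms(2) by auto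
  then have "\<forall>\<^sub>F i in sequentially. pd_step G i S = verts G"
    using eventually_sequentially by blast
  with assms(1) show ?thesis
    by (simp add: power_dominating_def pd_final_eqI)
qed

lemma power_dominating_if_meets_both:
  assumes "S \<subseteq> verts G" "S \<inter> U \<noteq> {}" "S \<inter> V \<noteq> {}"
  shows "power_dominating G S"
proof (rule power_dominating_if_step_eq_verts[where k = 0])
  obtain u v where "u \<in> S" "u \<in> U" "v \<in> S" "v \<in> V"
    using assms by auto
  then have "U \<union> V \<subseteq> pd_step G 0 S"
    using closed_nbhd_left[of u] closed_nbhd_right[of v] by (auto simp: closed_nbhd_set_def)
  then show "pd_step G 0 S = verts G"
    using pd_step_subset[OF assms(1), of 0] verts_eq by blast
qed (fact assms(1))

lemma power_dominating_if_misses_at_most_one: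
  assumes "S \<subseteq> U" "S \<noteq> {}" "V \<noteq> {}" "card (U - S) \<le> 1"
  shows "power_dominating G S"
proof (rule power_dominating_if_step_eq_verts[where k = 1])
  show sub: "S \<subseteq> verts G"
    using assms(1) verts_eq by auto
  \<comment> \<open>Any single vertex of the nonempty set \<open>S\<close> already dominates all of
    \<open>V\<close>.\<close>
  have P0: "pd_step G 0 S = S \<union> V"
    using assms(1,2) closed_nbhd_left by (fastforce simp: closed_nbhd_set_def)
  have "U - S \<subseteq> pd_step G 1 S"
  proof
    fix w assume "w \<in> U - S"
    then have "U - S = {w}"
      using assms(4) finite_sides(1) card_le_Suc0_iff_eq[of "U - S"] by auto
    obtain v where v: "v \<in> V"
      using assms(3) by auto
    have "{w} = closed_nbhd G v - pd_step G 0 S"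
      using \<open>U - S = {w}\<close> v disjoint_sides closed_nbhd_right[OF v] P0 by auto
    moreover have "v \<in> pd_step G 0 S"
      using v P0 by auto
    ultimately show "w \<in> pd_step G 1 S"
      by auto
  qed
  then have "U \<union> V \<subseteq> pd_step G 1 S"
    using P0 pd_step_mono[of 0 1 G S] by auto
  then show "pd_step G 1 S = verts G"
    using pd_step_subset[OF sub, of 1] verts_eq by blast
qed

text \<open>Invariant of the stuck process. It is an inclusion rather than an equality so that it
  also covers \<open>S = {}\<close>, where nothing is ever observed.\<close>

lemma pd_step_subset_if_misses_two:
  assumes "S \<subseteq> U" "2 \<le> card (U - S)"
  shows "pd_step G i S \<subseteq> S \<union> V"
proof (induction i)
  case 0
  then show ?case
    using assms(1) closed_nbhd_left by (fastforce simp: closed_nbhd_set_def)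
next
  case (Suc i)
  have "w \<in> S \<union> V"
    if v: "v \<in> pd_step G i S" and w: "{w} = closed_nbhd G v - pd_step G i S" for v w
  proof (cases "v \<in> V")
    case True
    \<comment> \<open>By the induction hypothesis no vertex of \<open>U - S\<close> is observed yet,
      so all of them are unobserved neighbors of \<open>v\<close>.\<close>
    then have "U - S \<subseteq> {w}"
      unfolding w closed_nbhd_right[OF True] using Suc disjoint_sides by auto
    then have "card (U - S) \<le> 1"
      using card_mono[of "{w}" "U - S"] by simp
    with assms(2) show ?thesis by simp
  next
    case False
    then have "v \<in> U"
      using v Suc assms(1) by auto
    then show ?thesis
      using w v closed_nbhd_left[of v] by auto
  qed
  with Suc show ?case by auto
qed

lemma failed_power_dominating_if_misses_two:
  assumes "S \<subseteq> U" "2 \<le> card (U - S)"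
  shows "failed_power_dominating G S"
proof -
  have sub: "S \<subseteq> verts G"
    using assms(1) verts_eq by auto
  \<comment> \<open>The eventual value is itself an iterate, so it inherits the invariant.\<close>
  obtain i where "pd_step G i S = pd_final G S"
    using eventually_pd_step_eq_pd_final[OF sub] by (auto simp: eventually_sequentially)
  then have "pd_final G S \<subseteq> S \<union> V"
    using pd_step_subset_if_misses_two[OF assms, of i] by simp
  moreover have "U - S \<noteq> {}"
    using assms(2) by (metis card.empty not_numeral_le_zero)
  ultimately have "pd_final G S \<noteq> verts G"
    using verts_eq disjoint_sides by blast
  with sub show ?thesis
    by (simp add: failed_power_dominating_def power_dominating_def)
qed

text \<open>For nonempty \<open>S\<close> this is the contrapositive of
  \<open>power_dominating_if_misses_at_most_one\<close>; for empty \<open>S\<close> the left side is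
  0.\<close>

lemma card_failed_le_if_subset_left:
  assumes "failed_power_dominating G S" "S \<subseteq> U" "V \<noteq> {}"
  shows "card S \<le> card U - 2"
proof (cases "S = {}")
  case False
  then have "2 \<le> card (U - S)"
    using power_dominating_if_misses_at_most_one[of S] assms
    by (force simp: failed_power_dominating_def)
  then show ?thesis
    using card_Diff_subset[of S U] finite_subset[OF assms(2)] finite_sides(1) assms(2)
    by simp
qed simp

lemma failed_pd_number_eq:
  assumes "card V \<le> card U" "V \<noteq> {}"
  shows "failed_pd_number G = card U - 2"
  unfolding failed_pd_number_def
proof (rule Max_eqI[OF finite_failed_power_dominating])
  \<comment> \<open>When \<open>S\<close> lies in \<open>V\<close>, the swapped bound needs the
    opposite side \<open>U\<close> to be nonempty.\<close>
  have "U \<noteq> {}"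
    using assms finite_sides by auto
  fix k assume "k \<in> {card S |S. failed_power_dominating G S}"
  then obtain S where S: "failed_power_dominating G S" "k = card S"
    by auto
  then consider "S \<subseteq> U" | "S \<subseteq> V"
    using power_dominating_if_meets_both[of S] verts_eq
    by (auto simp: failed_power_dominating_def)
  then show "k \<le> card U - 2"
  proof cases
    case 1
    with S assms(2) show ?thesis
      using card_failed_le_if_subset_left by simp
  next
    case 2
    then have "card S \<le> card V - 2"
      using S \<open>U \<noteq> {}\<close> complete_bipartite_graph.card_failed_le_if_subset_left[OF swap] by simp
    with S assms(1) show ?thesis by simp
  qed
next
  show "card U - 2 \<in> {card S |S. failed_power_dominating G S}"
  proof (cases "2 \<le> card U")
    case True
    obtain S where S: "S \<subseteq> U" "card S = card U - 2"
      using obtain_subset_with_card_n[of "card U - 2" U] by auto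
    then have "card (U - S) = 2"
      using card_Diff_subset[of S U] finite_subset[OF S(1)] finite_sides(1) True by simp
    with S have "failed_power_dominating G S"
      by (simp add: failed_power_dominating_if_misses_two)
    with S(2) show ?thesis
      by (metis (mono_tags, lifting) mem_Collect_eq)
  next
    case False
    \<comment> \<open>Here truncated subtraction gives \<open>card U - 2 = 0\<close>, which the
      empty set attains.\<close>
    have "failed_power_dominating G {}"
      using assms(2) verts_eq by (simp add: failed_power_dominating_empty)
    then show ?thesis
      using False by (auto intro!: exI[of _ "{}"])
  qed
qed

end

theorem theorem6:
  fixes G :: "('a, 'b) pre_digraph" and m n :: nat
  assumes "complete_bipartite_digraph m n G"
    and "m \<ge> n" and "n \<ge> 1"
  shows "failed_pd_number G = (if m \<ge> 2 then m - 2 else 0)"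
proof -
  obtain U V where "graph G" and UV: "verts G = U \<union> V" "U \<inter> V = {}"
      "card U = m" "card V = n" "arcs_ends G = U \<times> V \<union> V \<times> U"
    using assms(1) unfolding complete_bipartite_digraph_def by blast
  then interpret complete_bipartite_graph G U V
    by (simp add: complete_bipartite_graph_def complete_bipartite_graph_axioms_def)
  have "failed_pd_number G = m - 2"
    using failed_pd_number_eq UV(3,4) assms(2,3) by force
  \<comment> \<open>For \<open>m < 2\<close> the truncated difference \<open>m - 2\<close> is 0, so
    one formula serves both branches.\<close>
  then show ?thesis by simp
qed

end
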